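(* Let $(\Xi,\rho,\theta,\Sigma)$ be a continuous groupoid action with $\Xi$ locally compact. If $\Sigma$ is compact and minimal, and $\Xi$ is open and strongly non-compact, then the action is non-wandering.
   Context: All topological spaces are Hausdorff. A groupoid $\Xi$ is a small category in which all arrows are invertible; $X=\Xi^{(0)}$ is its unit space, $d,r:\Xi\to X$ are the source and range maps, and $\xi\eta$ is defined iff $d(\xi)=r(\eta)$. A topological groupoid is a groupoid with a (Hausdorff) topology making inversion and multiplication continuous (composable pairs carry the topology induced from $\Xi\times\Xi$); $X$ has the subspace topology. $\Xi$ is called open if $d:\Xi\to X$ is an open map. For $x\in X$, $\Xi_x=d^{-1}(\{x\})$. $\Xi$ is strongly non-compact if $\Xi_x$ is non-compact for every $x\in X$. A continuous groupoid action $(\Xi,\rho,\theta,\Sigma)$ consists of a topological groupoid $\Xi$, a Hausdorff space $\Sigma$, a continuous surjection $\rho:\Sigma\to X$ (the anchor) and a continuous map $\theta:\{(\xi,\sigma)\in\Xi\times\Sigma: d(\xi)=\rho(\sigma)\}\to\Sigma$, $\theta_\xi(\sigma)=\xi\bullet\sigma$, with $\rho(\sigma)\bullet\sigma=\sigma$ and: if $d(\xi)=r(\eta)$ and $d(\eta)=\rho(\sigma)$ then $d(\xi)=\rho(\eta\bullet\sigma)$ and $(\xi\eta)\bullet\sigma=\xi\bullet(\eta\bullet\sigma)$. For $M,N\subset\Sigma$, $\xi\bullet M=\{\xi\bullet\sigma:\sigma\in M,\ \rho(\sigma)=d(\xi)\}$ and $\widetilde\Xi_M^N=\{\xi\in\Xi:(\xi\bullet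 M)\cap N\neq\emptyset\}$. $M$ is invariant if $\xi\bullet M\subset M$ for all $\xi\in\Xi$. A non-empty closed invariant subset is minimal if it contains no proper non-void closed invariant subset; $\Sigma$ minimal means this holds for $M=\Sigma$. A point $\sigma$ is wandering if it has a neighborhood $W$ such that $\widetilde\Xi_W^W$ is relatively compact (has compact closure), and non-wandering otherwise. The action is non-wandering if all points of $\Sigma$ are non-wandering. *)

theory Defs
  imports "HOL-Analysis.Analysis"
begin

text \<open>
  Groupoids are presented by their arrows alone: \<open>G\<close> is the set of arrows and the source
  map \<open>d\<close> and the range map \<open>r\<close> take values in the arrows themselves, an object being
  identified with its identity arrow. The operation \<open>mult \<xi> \<eta>\<close> is only meaningful for
  arrows with \<open>d \<xi> = r \<eta>\<close>; outside that domain, and outside \<open>G\<close>, the functions are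
  unconstrained.
\<close>

locale groupoid =
  fixes G :: "'g set"
    and d r :: "'g \<Rightarrow> 'g"
    and mult :: "'g \<Rightarrow> 'g \<Rightarrow> 'g"
    and ginv :: "'g \<Rightarrow> 'g"
  assumes d_closed: "\<xi> \<in> G \<Longrightarrow> d \<xi> \<in> G"
    and r_closed: "\<xi> \<in> G \<Longrightarrow> r \<xi> \<in> G"
    and d_d: "\<xi> \<in> G \<Longrightarrow> d (d \<xi>) = d \<xi>"
    and r_d: "\<xi> \<in> G \<Longrightarrow> r (d \<xi>) = d \<xi>"
    and d_r: "\<xi> \<in> G \<Longrightarrow> d (r \<xi>) = r \<xi>"
    and r_r: "\<xi> \<in> G \<Longrightarrow> r (r \<xi>) = r \<xi>"
    and mult_closed: "\<lbrakk>\<xi> \<in> G; \<eta> \<in> G; d \<xi> = r \<eta>\<rbrakk> \<Longrightarrow> mult \<xi> \<eta> \<in> G"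
    and d_mult: "\<lbrakk>\<xi> \<in> G; \<eta> \<in> G; d \<xi> = r \<eta>\<rbrakk> \<Longrightarrow> d (mult \<xi> \<eta>) = d \<eta>"
    and r_mult: "\<lbrakk>\<xi> \<in> G; \<eta> \<in> G; d \<xi> = r \<eta>\<rbrakk> \<Longrightarrow> r (mult \<xi> \<eta>) = r \<xi>"
    and mult_assoc: "\<lbrakk>\<xi> \<in> G; \<eta> \<in> G; \<zeta> \<in> G; d \<xi> = r \<eta>; d \<eta> = r \<zeta>\<rbrakk>
          \<Longrightarrow> mult (mult \<xi> \<eta>) \<zeta> = mult \<xi> (mult \<eta> \<zeta>)"
    and mult_d: "\<xi> \<in> G \<Longrightarrow> mult \<xi> (d \<xi>) = \<xi>"
    and r_mult_self: "\<xi> \<in> G \<Longrightarrow> mult (r \<xi>) \<xi> = \<xi>"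
    and ginv_closed: "\<xi> \<in> G \<Longrightarrow> ginv \<xi> \<in> G"
    and d_ginv: "\<xi> \<in> G \<Longrightarrow> d (ginv \<xi>) = r \<xi>"
    and r_ginv: "\<xi> \<in> G \<Longrightarrow> r (ginv \<xi>) = d \<xi>"
    and ginv_mult: "\<xi> \<in> G \<Longrightarrow> mult (ginv \<xi>) \<xi> = d \<xi>"
    and mult_ginv: "\<xi> \<in> G \<Longrightarrow> mult \<xi> (ginv \<xi>) = r \<xi>"

definition composable_pairs :: "'g set \<Rightarrow> ('g \<Rightarrow> 'g) \<Rightarrow> ('g \<Rightarrow> 'g) \<Rightarrow> ('g \<times> 'g) set" where
  "composable_pairs G d r = {(\<xi>, \<eta>). \<xi> \<in> G \<and> \<eta> \<in> G \<and> d \<xi> = r \<eta>}"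

text \<open>A topology \<open>T\<close> on the arrows carries the arrow set as its underlying space. Continuity
  of \<open>d\<close> and \<open>r\<close> is a consequence, since \<open>d \<xi> = mult (ginv \<xi>) \<xi>\<close>.\<close>

locale topological_groupoid = groupoid "topspace T" d r mult ginv
  for T :: "'g topology"
    and d r :: "'g \<Rightarrow> 'g"
    and mult :: "'g \<Rightarrow> 'g \<Rightarrow> 'g"
    and ginv :: "'g \<Rightarrow> 'g" +
  assumes Hausdorff_T: "Hausdorff_space T"
    and continuous_ginv: "continuous_map T T ginv"
    and continuous_mult:
      "continuous_map (subtopology (prod_topology T T) (composable_pairs (topspace T) d r)) T
         (\<lambda>(\<xi>, \<eta>). mult \<xi> \<eta>)"

definition unit_space :: "'g topology \<Rightarrow> ('g \<Rightarrow> 'g) \<Rightarrow> 'g set" where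
  "unit_space T d = d ` topspace T"

lemma (in topological_groupoid) unit_space_eq_range: "unit_space T d = r ` topspace T"
proof
  show "unit_space T d \<subseteq> r ` topspace T"
  proof
    fix x assume "x \<in> unit_space T d"
    then obtain \<xi> where \<xi>: "\<xi> \<in> topspace T" "x = d \<xi>" by (auto simp: unit_space_def)
    then have "r x = x" "x \<in> topspace T" by (simp_all add: r_d d_closed)
    then show "x \<in> r ` topspace T" by (metis imageI)
  qed
  show "r ` topspace T \<subseteq> unit_space T d"
  proof
    fix x assume "x \<in> r ` topspace T"
    then obtain \<xi> where \<xi>: "\<xi> \<in> topspace T" "x = r \<xi>" by auto
    then have "d x = x" "x \<in> topspace T" by (simp_all add: d_r r_closed)
    then show "x \<in> unit_space T d" unfolding unit_space_def by (metis imageI)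
  qed
qed

definition unit_topology :: "'g topology \<Rightarrow> ('g \<Rightarrow> 'g) \<Rightarrow> 'g topology" where
  "unit_topology T d = subtopology T (unit_space T d)"

definition open_groupoid :: "'g topology \<Rightarrow> ('g \<Rightarrow> 'g) \<Rightarrow> bool" where
  "open_groupoid T d \<longleftrightarrow> open_map T (unit_topology T d) d"

definition source_fibre :: "'g topology \<Rightarrow> ('g \<Rightarrow> 'g) \<Rightarrow> 'g \<Rightarrow> 'g set" where
  "source_fibre T d x = {\<xi> \<in> topspace T. d \<xi> = x}"

definition strongly_non_compact :: "'g topology \<Rightarrow> ('g \<Rightarrow> 'g) \<Rightarrow> bool" where
  "strongly_non_compact T d \<longleftrightarrow>
     (\<forall>x \<in> unit_space T d. \<not> compactin T (source_fibre T d x))"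

definition action_domain ::
    "'g topology \<Rightarrow> ('g \<Rightarrow> 'g) \<Rightarrow> 's topology \<Rightarrow> ('s \<Rightarrow> 'g) \<Rightarrow> ('g \<times> 's) set" where
  "action_domain T d S \<rho> = {(\<xi>, \<sigma>). \<xi> \<in> topspace T \<and> \<sigma> \<in> topspace S \<and> d \<xi> = \<rho> \<sigma>}"

locale groupoid_action = topological_groupoid T d r mult ginv
  for T :: "'g topology"
    and d r :: "'g \<Rightarrow> 'g"
    and mult :: "'g \<Rightarrow> 'g \<Rightarrow> 'g"
    and ginv :: "'g \<Rightarrow> 'g" +
  fixes S :: "'s topology"
    and \<rho> :: "'s \<Rightarrow> 'g"
    and \<theta> :: "'g \<Rightarrow> 's \<Rightarrow> 's"
  assumes Hausdorff_S: "Hausdorff_space S"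
    and continuous_anchor: "continuous_map S (unit_topology T d) \<rho>"
    and surj_anchor: "\<rho> ` topspace S = unit_space T d"
    and continuous_act:
      "continuous_map (subtopology (prod_topology T S) (action_domain T d S \<rho>)) S
         (\<lambda>(\<xi>, \<sigma>). \<theta> \<xi> \<sigma>)"
    and act_unit: "\<sigma> \<in> topspace S \<Longrightarrow> \<theta> (\<rho> \<sigma>) \<sigma> = \<sigma>"
    and anchor_act:
      "\<lbrakk>\<xi> \<in> topspace T; \<eta> \<in> topspace T; \<sigma> \<in> topspace S; d \<xi> = r \<eta>; d \<eta> = \<rho> \<sigma>\<rbrakk>
         \<Longrightarrow> d \<xi> = \<rho> (\<theta> \<eta> \<sigma>)"
    and act_mult:
      "\<lbrakk>\<xi> \<in> topspace T; \<eta> \<in> topspace T; \<sigma> \<in> topspace S; d \<xi> = r \<eta>; d \<eta> = \<rho> \<sigma>\<rbrakk>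
         \<Longrightarrow> \<theta> (mult \<xi> \<eta>) \<sigma> = \<theta> \<xi> (\<theta> \<eta> \<sigma>)"

definition translate ::
    "('g \<Rightarrow> 'g) \<Rightarrow> ('s \<Rightarrow> 'g) \<Rightarrow> ('g \<Rightarrow> 's \<Rightarrow> 's) \<Rightarrow> 'g \<Rightarrow> 's set \<Rightarrow> 's set" where
  "translate d \<rho> \<theta> \<xi> M = {\<theta> \<xi> \<sigma> | \<sigma>. \<sigma> \<in> M \<and> \<rho> \<sigma> = d \<xi>}"

definition recurrence_set ::
    "'g topology \<Rightarrow> ('g \<Rightarrow> 'g) \<Rightarrow> ('s \<Rightarrow> 'g) \<Rightarrow> ('g \<Rightarrow> 's \<Rightarrow> 's) \<Rightarrow> 's set \<Rightarrow> 's set \<Rightarrow> 'g set" where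
  "recurrence_set T d \<rho> \<theta> M N = {\<xi> \<in> topspace T. translate d \<rho> \<theta> \<xi> M \<inter> N \<noteq> {}}"

definition invariant_set ::
    "'g topology \<Rightarrow> ('g \<Rightarrow> 'g) \<Rightarrow> ('s \<Rightarrow> 'g) \<Rightarrow> ('g \<Rightarrow> 's \<Rightarrow> 's) \<Rightarrow> 's set \<Rightarrow> bool" where
  "invariant_set T d \<rho> \<theta> M \<longleftrightarrow> (\<forall>\<xi> \<in> topspace T. translate d \<rho> \<theta> \<xi> M \<subseteq> M)"

definition minimal_set ::
    "'g topology \<Rightarrow> ('g \<Rightarrow> 'g) \<Rightarrow> 's topology \<Rightarrow> ('s \<Rightarrow> 'g) \<Rightarrow> ('g \<Rightarrow> 's \<Rightarrow> 's) \<Rightarrow> 's set \<Rightarrow> bool" where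
  "minimal_set T d S \<rho> \<theta> M \<longleftrightarrow>
     M \<noteq> {} \<and> closedin S M \<and> invariant_set T d \<rho> \<theta> M \<and>
     \<not> (\<exists>N. N \<subset> M \<and> N \<noteq> {} \<and> closedin S N \<and> invariant_set T d \<rho> \<theta> N)"

definition minimal_action ::
    "'g topology \<Rightarrow> ('g \<Rightarrow> 'g) \<Rightarrow> 's topology \<Rightarrow> ('s \<Rightarrow> 'g) \<Rightarrow> ('g \<Rightarrow> 's \<Rightarrow> 's) \<Rightarrow> bool" where
  "minimal_action T d S \<rho> \<theta> \<longleftrightarrow> minimal_set T d S \<rho> \<theta> (topspace S)"

definition neighbourhood_of :: "'s topology \<Rightarrow> 's \<Rightarrow> 's set \<Rightarrow> bool" where
  "neighbourhood_of S \<sigma> W \<longleftrightarrow> W \<subseteq> topspace S \<and> (\<exists>U. openin S U \<and> \<sigma> \<in> U \<and> U \<subseteq> W)"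

definition relatively_compact_in :: "'g topology \<Rightarrow> 'g set \<Rightarrow> bool" where
  "relatively_compact_in T A \<longleftrightarrow> compactin T (T closure_of A)"

definition wandering_point ::
    "'g topology \<Rightarrow> ('g \<Rightarrow> 'g) \<Rightarrow> 's topology \<Rightarrow> ('s \<Rightarrow> 'g) \<Rightarrow> ('g \<Rightarrow> 's \<Rightarrow> 's) \<Rightarrow> 's \<Rightarrow> bool" where
  "wandering_point T d S \<rho> \<theta> \<sigma> \<longleftrightarrow>
     (\<exists>W. neighbourhood_of S \<sigma> W \<and> relatively_compact_in T (recurrence_set T d \<rho> \<theta> W W))"

definition non_wandering_action ::
    "'g topology \<Rightarrow> ('g \<Rightarrow> 'g) \<Rightarrow> 's topology \<Rightarrow> ('s \<Rightarrow> 'g) \<Rightarrow> ('g \<Rightarrow> 's \<Rightarrow> 's) \<Rightarrow> bool" where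
  "non_wandering_action T d S \<rho> \<theta> \<longleftrightarrow> (\<forall>\<sigma> \<in> topspace S. \<not> wandering_point T d S \<rho> \<theta> \<sigma>)"

end

theory Submission
  imports Defs
begin

text \<open>
  Let \<open>U\<close> be a non-empty open subset of \<open>\<Sigma>\<close>. The points that some arrow carries into \<open>U\<close> form
  an invariant set with invariant complement. It is open because \<open>d\<close> is open: an arrow that
  carries \<open>\<sigma>\<close> into \<open>U\<close> can be perturbed so as to start at any unit close to \<open>\<rho> \<sigma>\<close>. By minimality
  it is everything. Since \<open>\<Xi>\<close> is locally compact, the perturbed arrows may be taken
  in a compact set, and since \<open>\<Sigma>\<close> is compact, a single compact set \<open>C\<close> of arrows suffices to carry
  \<^emph>\<open>every\<close> point of \<open>\<Sigma>\<close> into \<open>U\<close> (\<open>uniformly_compact_return\<close>).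

  Suppose that \<open>\<sigma> \<in> U\<close> and that the arrows returning \<open>U\<close> to itself lie in a compact set \<open>K\<close>. For an
  arrow \<open>\<xi>\<close> starting at \<open>\<rho> \<sigma>\<close> choose \<open>\<eta> \<in> C\<close> that carries \<open>\<xi> \<bullet> \<sigma>\<close> into \<open>U\<close>. Then \<open>\<eta>\<xi>\<close> returns \<open>\<sigma>\<close> to
  \<open>U\<close>, so it lies in \<open>K\<close>, and \<open>\<xi> \<in> C\<^sup>-\<^sup>1K\<close>. Thus the source fibre over \<open>\<rho> \<sigma>\<close>, which is closed, lies in
  the compact set \<open>C\<^sup>-\<^sup>1K\<close> and is compact, contrary to strong non-compactness.
\<close>

definition groupoid_set_mult ::
    "('g \<Rightarrow> 'g) \<Rightarrow> ('g \<Rightarrow> 'g) \<Rightarrow> ('g \<Rightarrow> 'g \<Rightarrow> 'g) \<Rightarrow> 'g set \<Rightarrow> 'g set \<Rightarrow> 'g set" where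
  "groupoid_set_mult d r m A B = {m \<xi> \<eta> | \<xi> \<eta>. \<xi> \<in> A \<and> \<eta> \<in> B \<and> d \<xi> = r \<eta>}"

context topological_groupoid
begin

lemma continuous_mult_compose:
  assumes "continuous_map X T f" "continuous_map X T g"
    and "\<And>x. x \<in> topspace X \<Longrightarrow> d (f x) = r (g x)"
  shows "continuous_map X T (\<lambda>x. mult (f x) (g x))"
proof -
  have "f x \<in> topspace T" "g x \<in> topspace T" if "x \<in> topspace X" for x
    using assms(1,2) that by (auto simp: continuous_map_def)
  then have "continuous_map X
      (subtopology (prod_topology T T) (composable_pairs (topspace T) d r)) (\<lambda>x. (f x, g x))"
    using assms by (auto simp: continuous_map_in_subtopology continuous_map_paired
        composable_pairs_def)
  from continuous_map_compose[OF this continuous_mult] show ?thesis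
    by (simp add: o_def)
qed

lemma continuous_d: "continuous_map T T d"
proof -
  have "continuous_map T T (\<lambda>\<xi>. mult (ginv \<xi>) \<xi>)"
    using continuous_ginv by (intro continuous_mult_compose) (auto simp: d_ginv)
  then show ?thesis
    by (rule continuous_map_eq) (auto simp: ginv_mult)
qed

lemma continuous_r: "continuous_map T T r"
proof -
  have "continuous_map T T (\<lambda>\<xi>. mult \<xi> (ginv \<xi>))"
    using continuous_ginv by (intro continuous_mult_compose) (auto simp: r_ginv)
  then show ?thesis
    by (rule continuous_map_eq) (auto simp: mult_ginv)
qed

lemma closedin_source_fibre:
  assumes "x \<in> topspace T"
  shows "closedin T (source_fibre T d x)"
  unfolding source_fibre_def
  using closedin_continuous_maps_eq[OF Hausdorff_T continuous_d, of "\<lambda>_. x"] assms by auto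

lemma closedin_composable_pairs:
  "closedin (prod_topology T T) (composable_pairs (topspace T) d r)"
proof -
  have "closedin (prod_topology T T)
      {p \<in> topspace (prod_topology T T). (d \<circ> fst) p = (r \<circ> snd) p}"
    by (intro closedin_continuous_maps_eq[OF Hausdorff_T]
        continuous_map_compose[OF continuous_map_fst continuous_d]
        continuous_map_compose[OF continuous_map_snd continuous_r])
  moreover have "{p \<in> topspace (prod_topology T T). (d \<circ> fst) p = (r \<circ> snd) p} =
      composable_pairs (topspace T) d r"
    by (auto simp: composable_pairs_def)
  ultimately show ?thesis by simp
qed

text \<open>Composability is a closed condition because the groupoid is Hausdorff, so the composable
  pairs in a compact rectangle form a compact set.\<close>

lemma compactin_set_mult:
  assumes "compactin T A" "compactin T B"
  shows "compactin T (groupoid_set_mult d r mult A B)"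
proof -
  let ?P = "composable_pairs (topspace T) d r"
  have sub: "A \<subseteq> topspace T" "B \<subseteq> topspace T"
    using assms by (auto simp: compactin_subset_topspace)
  have "compactin (prod_topology T T) (?P \<inter> A \<times> B)"
    using assms by (intro closed_Int_compactin closedin_composable_pairs)
      (simp add: compactin_Times)
  then have "compactin (subtopology (prod_topology T T) ?P) (?P \<inter> A \<times> B)"
    by (simp add: compactin_subtopology)
  then have "compactin T ((\<lambda>(\<xi>, \<eta>). mult \<xi> \<eta>) ` (?P \<inter> A \<times> B))"
    by (rule image_compactin[OF _ continuous_mult])
  moreover have "(\<lambda>(\<xi>, \<eta>). mult \<xi> \<eta>) ` (?P \<inter> A \<times> B) = groupoid_set_mult d r mult A B"
    using sub by (force simp: composable_pairs_def groupoid_set_mult_def)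
  ultimately show ?thesis by simp
qed

lemma ginv_mult_cancel:
  assumes "\<eta> \<in> topspace T" "\<xi> \<in> topspace T" "d \<eta> = r \<xi>"
  shows "mult (ginv \<eta>) (mult \<eta> \<xi>) = \<xi>"
  using assms by (metis d_ginv ginv_closed ginv_mult mult_assoc r_mult_self)

end

definition carried_into ::
    "('g \<Rightarrow> 'g) \<Rightarrow> 's topology \<Rightarrow> ('s \<Rightarrow> 'g) \<Rightarrow> ('g \<Rightarrow> 's \<Rightarrow> 's) \<Rightarrow> 'g set \<Rightarrow> 's set \<Rightarrow> 's set" where
  "carried_into d S \<rho> \<theta> A U = {\<sigma> \<in> topspace S. \<exists>\<eta>\<in>A. d \<eta> = \<rho> \<sigma> \<and> \<theta> \<eta> \<sigma> \<in> U}"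

lemma carried_into_mono:
  "A \<subseteq> B \<Longrightarrow> carried_into d S \<rho> \<theta> A U \<subseteq> carried_into d S \<rho> \<theta> B U"
  by (auto simp: carried_into_def)

context groupoid_action
begin

lemma act_closed:
  assumes "\<xi> \<in> topspace T" "\<sigma> \<in> topspace S" "d \<xi> = \<rho> \<sigma>"
  shows "\<theta> \<xi> \<sigma> \<in> topspace S"
  using continuous_map_image_subset_topspace[OF continuous_act] assms
  by (force simp: action_domain_def)

lemma anchor_act_eq_r:
  assumes "\<xi> \<in> topspace T" "\<sigma> \<in> topspace S" "d \<xi> = \<rho> \<sigma>"
  shows "\<rho> (\<theta> \<xi> \<sigma>) = r \<xi>"
  using anchor_act[of "r \<xi>" \<xi> \<sigma>] assms by (simp add: d_r r_closed)

text \<open>By continuity of the action, arrows near \<open>\<eta>\<close> carry points near \<open>\<sigma>\<close> into \<open>U\<close> whenever they can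
  be applied. Openness of \<open>d\<close> makes sure that to each point near \<open>\<sigma>\<close> one of them can be applied.\<close>

lemma open_carried_into_nearby:
  assumes d_open: "open_groupoid T d" and "openin S U" "openin T V" "\<eta> \<in> V"
    and \<sigma>: "\<sigma> \<in> topspace S" "d \<eta> = \<rho> \<sigma>" "\<theta> \<eta> \<sigma> \<in> U"
  obtains B where "openin S B" "\<sigma> \<in> B" "B \<subseteq> carried_into d S \<rho> \<theta> V U"
proof -
  let ?D = "action_domain T d S \<rho>"
  have \<eta>: "\<eta> \<in> topspace T"
    using assms openin_subset by blast
  define Q where "Q = {p \<in> topspace (subtopology (prod_topology T S) ?D).
      (\<lambda>(\<xi>, \<sigma>). \<theta> \<xi> \<sigma>) p \<in> U}"
  have "openin (subtopology (prod_topology T S) ?D) Q"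
    unfolding Q_def by (rule openin_continuous_map_preimage[OF continuous_act \<open>openin S U\<close>])
  then obtain O' where O': "openin (prod_topology T S) O'" "Q = O' \<inter> ?D"
    by (auto simp: openin_subtopology)
  have "(\<eta>, \<sigma>) \<in> Q"
    using \<eta> \<sigma> by (auto simp: Q_def action_domain_def)
  then obtain A B where AB: "openin T A" "openin S B" "\<eta> \<in> A" "\<sigma> \<in> B" "A \<times> B \<subseteq> O'"
    using O' openin_prod_topology_alt[of T S O'] by blast
  define B' where "B' = B \<inter> {\<tau> \<in> topspace S. \<rho> \<tau> \<in> d ` (A \<inter> V)}"
  have "openin (unit_topology T d) (d ` (A \<inter> V))"
    using d_open AB(1) \<open>openin T V\<close> by (auto simp: open_groupoid_def open_map_def)
  then have "openin S B'"
    unfolding B'_def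
    using AB(2) openin_continuous_map_preimage[OF continuous_anchor] by blast
  moreover have "\<sigma> \<in> B'"
    using AB \<sigma> \<open>\<eta> \<in> V\<close> unfolding B'_def by (metis (mono_tags, lifting) IntI imageI mem_Collect_eq)
  moreover have "B' \<subseteq> carried_into d S \<rho> \<theta> V U"
  proof
    fix \<tau> assume "\<tau> \<in> B'"
    then obtain \<xi> where \<xi>: "\<tau> \<in> B" "\<tau> \<in> topspace S" "\<xi> \<in> A" "\<xi> \<in> V" "d \<xi> = \<rho> \<tau>"
      unfolding B'_def by fastforce
    moreover have "\<xi> \<in> topspace T"
      using \<xi> AB(1) openin_subset by blast
    ultimately have "(\<xi>, \<tau>) \<in> Q"
      using AB(5) O'(2) by (auto simp: action_domain_def)
    then have "\<theta> \<xi> \<tau> \<in> U"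
      by (simp add: Q_def)
    then show "\<tau> \<in> carried_into d S \<rho> \<theta> V U"
      using \<xi> by (auto simp: carried_into_def)
  qed
  ultimately show ?thesis by (rule that)
qed

lemma openin_carried_into:
  assumes "open_groupoid T d" "openin S U"
  shows "openin S (carried_into d S \<rho> \<theta> (topspace T) U)"
proof (subst openin_subopen, intro ballI)
  fix \<sigma> assume "\<sigma> \<in> carried_into d S \<rho> \<theta> (topspace T) U"
  then obtain \<eta> where "\<sigma> \<in> topspace S" "\<eta> \<in> topspace T" "d \<eta> = \<rho> \<sigma>" "\<theta> \<eta> \<sigma> \<in> U"
    by (auto simp: carried_into_def)
  then show "\<exists>B. openin S B \<and> \<sigma> \<in> B \<and> B \<subseteq> carried_into d S \<rho> \<theta> (topspace T) U"
    using open_carried_into_nearby[OF assms, of "topspace T" \<eta> \<sigma>] by (metis openin_topspace)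
qed

text \<open>If \<open>\<eta>\<close> carries \<open>\<xi> \<bullet> \<sigma>\<close> into \<open>U\<close>, then \<open>\<eta>\<xi>\<close> carries \<open>\<sigma>\<close> into \<open>U\<close>.\<close>

lemma invariant_complement_carried_into:
  "invariant_set T d \<rho> \<theta> (topspace S - carried_into d S \<rho> \<theta> (topspace T) U)"
proof -
  have "\<sigma> \<in> carried_into d S \<rho> \<theta> (topspace T) U"
    if \<xi>: "\<xi> \<in> topspace T" "\<sigma> \<in> topspace S" "d \<xi> = \<rho> \<sigma>"
      and moved: "\<theta> \<xi> \<sigma> \<in> carried_into d S \<rho> \<theta> (topspace T) U" for \<xi> \<sigma>
  proof -
    obtain \<eta> where \<eta>: "\<eta> \<in> topspace T" "d \<eta> = r \<xi>" "\<theta> \<eta> (\<theta> \<xi> \<sigma>) \<in> U"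
      using moved anchor_act_eq_r[OF \<xi>] by (auto simp: carried_into_def)
    then have "mult \<eta> \<xi> \<in> topspace T" "d (mult \<eta> \<xi>) = \<rho> \<sigma>" "\<theta> (mult \<eta> \<xi>) \<sigma> \<in> U"
      using \<xi> by (auto simp: mult_closed d_mult act_mult)
    then show ?thesis
      using \<xi> by (auto simp: carried_into_def)
  qed
  then show ?thesis
    by (auto simp: invariant_set_def translate_def act_closed)
qed

lemma minimal_carried_into_eq_topspace:
  assumes "minimal_action T d S \<rho> \<theta>" "open_groupoid T d" "openin S U" "U \<noteq> {}"
  shows "carried_into d S \<rho> \<theta> (topspace T) U = topspace S"
proof -
  let ?C = "carried_into d S \<rho> \<theta> (topspace T) U"
  have sub: "?C \<subseteq> topspace S"
    by (auto simp: carried_into_def)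
  have closed: "closedin S (topspace S - ?C)"
    using openin_carried_into[OF assms(2,3)] by blast
  obtain \<sigma> where \<sigma>: "\<sigma> \<in> U" "\<sigma> \<in> topspace S"
    using assms(3,4) openin_subset by blast
  then have "\<rho> \<sigma> \<in> unit_space T d"
    using surj_anchor by blast
  then have "\<rho> \<sigma> \<in> topspace T" "d (\<rho> \<sigma>) = \<rho> \<sigma>"
    by (auto simp: unit_space_def d_closed d_d)
  then have "\<sigma> \<in> ?C"
    using \<sigma> by (auto simp: carried_into_def act_unit)
  then have "topspace S - ?C \<subset> topspace S"
    using \<sigma> by blast
  then have "topspace S - ?C = {}"
    using assms(1) closed invariant_complement_carried_into[of U]
    unfolding minimal_action_def minimal_set_def by blast
  then show ?thesis
    using sub by blast
qed

text \<open>Local compactness gives each point a neighbourhood served by one compact set of arrows, and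
  finitely many of these neighbourhoods cover \<open>S\<close>. The compact sets are taken to contain the open
  sets \<open>V\<close> of arrows because only an open set has room for the perturbation of \<open>\<eta>\<close>.\<close>

lemma uniformly_compact_return:
  assumes "locally_compact_space T" "compact_space S" "minimal_action T d S \<rho> \<theta>"
    and "open_groupoid T d" "openin S U" "U \<noteq> {}"
  obtains C where "compactin T C" "carried_into d S \<rho> \<theta> C U = topspace S"
proof -
  define \<B> where "\<B> = {B. openin S B \<and> (\<exists>C. compactin T C \<and> B \<subseteq> carried_into d S \<rho> \<theta> C U)}"
  have cover: "topspace S \<subseteq> \<Union>\<B>"
  proof
    fix \<sigma> assume "\<sigma> \<in> topspace S"
    then have "\<sigma> \<in> carried_into d S \<rho> \<theta> (topspace T) U"
      using minimal_carried_into_eq_topspace[OF assms(3-6)] by simp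
    then obtain \<eta> where \<eta>: "\<sigma> \<in> topspace S" "\<eta> \<in> topspace T" "d \<eta> = \<rho> \<sigma>" "\<theta> \<eta> \<sigma> \<in> U"
      by (auto simp: carried_into_def)
    then obtain V C where VC: "openin T V" "compactin T C" "\<eta> \<in> V" "V \<subseteq> C"
      using assms(1) unfolding locally_compact_space_def by blast
    obtain B where "openin S B" "\<sigma> \<in> B" "B \<subseteq> carried_into d S \<rho> \<theta> V U"
      using open_carried_into_nearby[OF assms(4,5) VC(1,3) \<eta>(1,3,4)] by blast
    then show "\<sigma> \<in> \<Union>\<B>"
      using VC carried_into_mono[OF VC(4), of d S \<rho> \<theta> U] unfolding \<B>_def by blast
  qed
  moreover have "\<forall>B\<in>\<B>. openin S B"
    by (simp add: \<B>_def)
  ultimately obtain \<F> where \<F>: "finite \<F>" "\<F> \<subseteq> \<B>" "topspace S \<subseteq> \<Union>\<F>"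
    using assms(2) unfolding compact_space_alt by meson
  have "\<forall>B\<in>\<F>. \<exists>C. compactin T C \<and> B \<subseteq> carried_into d S \<rho> \<theta> C U"
    using \<F>(2) by (auto simp: \<B>_def)
  then obtain c where c: "\<And>B. B \<in> \<F> \<Longrightarrow> compactin T (c B)"
      "\<And>B. B \<in> \<F> \<Longrightarrow> B \<subseteq> carried_into d S \<rho> \<theta> (c B) U"
    by metis
  show ?thesis
  proof
    show "compactin T (\<Union>(c ` \<F>))"
      using \<F>(1) c(1) by (intro compactin_Union) auto
    have "B \<subseteq> carried_into d S \<rho> \<theta> (\<Union>(c ` \<F>)) U" if "B \<in> \<F>" for B
      using c(2)[OF that] carried_into_mono[of "c B" "\<Union>(c ` \<F>)" d S \<rho> \<theta> U] that by blast
    then have "topspace S \<subseteq> carried_into d S \<rho> \<theta> (\<Union>(c ` \<F>)) U"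
      using \<F>(3) by blast
    then show "carried_into d S \<rho> \<theta> (\<Union>(c ` \<F>)) U = topspace S"
      by (auto simp: carried_into_def)
  qed
qed

text \<open>An arrow \<open>\<xi>\<close> out of \<open>\<rho> \<sigma>\<close> becomes a return to \<open>U\<close> after composition with some \<open>\<eta> \<in> C\<close>, and
  \<open>\<xi> = \<eta>\<^sup>-\<^sup>1(\<eta>\<xi>)\<close>.\<close>

lemma source_fibre_subset_set_mult:
  assumes "carried_into d S \<rho> \<theta> C U = topspace S" "C \<subseteq> topspace T"
    and \<sigma>: "\<sigma> \<in> U" "\<sigma> \<in> topspace S"
  shows "source_fibre T d (\<rho> \<sigma>)
    \<subseteq> groupoid_set_mult d r mult (ginv ` C) (recurrence_set T d \<rho> \<theta> U U)"
proof
  fix \<xi> assume "\<xi> \<in> source_fibre T d (\<rho> \<sigma>)"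
  then have \<xi>: "\<xi> \<in> topspace T" "d \<xi> = \<rho> \<sigma>"
    by (auto simp: source_fibre_def)
  then have "\<theta> \<xi> \<sigma> \<in> carried_into d S \<rho> \<theta> C U"
    using assms(1) \<sigma>(2) by (simp add: act_closed)
  then obtain \<eta> where \<eta>: "\<eta> \<in> C" "\<eta> \<in> topspace T" "d \<eta> = r \<xi>" "\<theta> \<eta> (\<theta> \<xi> \<sigma>) \<in> U"
    using anchor_act_eq_r[OF \<xi>(1) \<sigma>(2) \<xi>(2)] assms(2) by (auto simp: carried_into_def)
  have "\<theta> (mult \<eta> \<xi>) \<sigma> \<in> U" "d (mult \<eta> \<xi>) = \<rho> \<sigma>" "mult \<eta> \<xi> \<in> topspace T"
    using \<xi> \<eta> \<sigma>(2) by (auto simp: act_mult d_mult mult_closed)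
  then have "mult \<eta> \<xi> \<in> recurrence_set T d \<rho> \<theta> U U"
    using \<sigma>(1) by (auto simp: recurrence_set_def translate_def)
  moreover have "d (ginv \<eta>) = r (mult \<eta> \<xi>)"
    using \<xi> \<eta> by (simp add: d_ginv r_mult)
  ultimately show
    "\<xi> \<in> groupoid_set_mult d r mult (ginv ` C) (recurrence_set T d \<rho> \<theta> U U)"
    using \<eta> \<xi> ginv_mult_cancel[of \<eta> \<xi>] unfolding groupoid_set_mult_def
    by (metis (mono_tags, lifting) imageI mem_Collect_eq)
qed

end

theorem proposition6p30:
  fixes T :: "'g topology" and S :: "'s topology"
    and d r :: "'g \<Rightarrow> 'g" and mult :: "'g \<Rightarrow> 'g \<Rightarrow> 'g" and ginv :: "'g \<Rightarrow> 'g"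
    and \<rho> :: "'s \<Rightarrow> 'g" and \<theta> :: "'g \<Rightarrow> 's \<Rightarrow> 's"
  assumes "groupoid_action T d r mult ginv S \<rho> \<theta>"
    and "locally_compact_space T"
    and "compact_space S"
    and "minimal_action T d S \<rho> \<theta>"
    and "open_groupoid T d"
    and "strongly_non_compact T d"
  shows "non_wandering_action T d S \<rho> \<theta>"
  unfolding non_wandering_action_def
proof (intro ballI notI)
  interpret groupoid_action T d r mult ginv S \<rho> \<theta> by (rule assms(1))
  fix \<sigma> assume \<sigma>: "\<sigma> \<in> topspace S" and "wandering_point T d S \<rho> \<theta> \<sigma>"
  then obtain W U where W: "openin S U" "\<sigma> \<in> U" "U \<subseteq> W"
      "compactin T (T closure_of recurrence_set T d \<rho> \<theta> W W)"
    unfolding wandering_point_def neighbourhood_of_def relatively_compact_in_def by blast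
  \<comment> \<open>The neighbourhood \<open>W\<close> need not be open, so the return argument is applied to \<open>U\<close>.\<close>
  define K where "K = T closure_of recurrence_set T d \<rho> \<theta> W W"
  have "recurrence_set T d \<rho> \<theta> U U \<subseteq> recurrence_set T d \<rho> \<theta> W W"
    using W(3) by (fastforce simp: recurrence_set_def translate_def)
  also have "\<dots> \<subseteq> K"
    unfolding K_def by (rule closure_of_subset) (auto simp: recurrence_set_def)
  finally have UK: "recurrence_set T d \<rho> \<theta> U U \<subseteq> K" .
  obtain C where C: "compactin T C" "carried_into d S \<rho> \<theta> C U = topspace S"
    using uniformly_compact_return[OF assms(2-5) W(1)] W(2) by blast
  have "source_fibre T d (\<rho> \<sigma>)
      \<subseteq> groupoid_set_mult d r mult (ginv ` C) (recurrence_set T d \<rho> \<theta> U U)"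
    using C \<sigma> W(2) by (intro source_fibre_subset_set_mult) (auto simp: compactin_subset_topspace)
  also have "\<dots> \<subseteq> groupoid_set_mult d r mult (ginv ` C) K"
    using UK by (auto simp: groupoid_set_mult_def)
  finally have fibre: "source_fibre T d (\<rho> \<sigma>) \<subseteq> groupoid_set_mult d r mult (ginv ` C) K" .
  have unit: "\<rho> \<sigma> \<in> unit_space T d"
    using \<sigma> surj_anchor by blast
  then have "closedin T (source_fibre T d (\<rho> \<sigma>))"
    by (intro closedin_source_fibre) (auto simp: unit_space_def d_closed)
  moreover have "compactin T (groupoid_set_mult d r mult (ginv ` C) K)"
    using C(1) W(4) unfolding K_def
    by (intro compactin_set_mult image_compactin[OF _ continuous_ginv])
  ultimately have "compactin T (source_fibre T d (\<rho> \<sigma>))"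
    using fibre by (meson closed_compactin)
  then show False
    using assms(6) unit by (simp add: strongly_non_compact_def)
qed

end
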